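(* Let $\Gamma$ be a tree with $l+1\geq 2$ leaves (vertices of degree $1$), with vertices $v_1,\dots,v_k$. Let $n\geq 1$ and let $\Gamma_n$ be the join of $\Gamma$ with the complete graph $K_n$ on vertices $w_1,\dots,w_n$. Let $H_n$ be the quotient of $\operatorname{Pic}^0(\Gamma_n)$ by the subgroup generated by the classes of $w_i-w_j$, $1\le i,j\le n$. Then $H_n$ can be generated by $l$ elements.
   Context: The join of two graphs $\Gamma_1,\Gamma_2$ is obtained from their disjoint union by joining every vertex of $\Gamma_1$ to every vertex of $\Gamma_2$ by an edge. For a finite connected graph $G$, $\operatorname{Div}(G)$ is the free abelian group on $V(G)$, $\operatorname{Div}^0(G)$ is the kernel of the degree map $\sum a_v v\mapsto\sum a_v$, the Laplacian $\Delta(G):\operatorname{Div}(G)\to\operatorname{Div}^0(G)$ is given by $v\mapsto(\deg v)\,v-\sum_{wv\in E(G)}w$, and the chip-firing group is $\operatorname{Pic}^0(G)=\operatorname{Div}^0(G)/\operatorname{im}\Delta(G)$. *)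

theory Defs
  imports
    "HOL-Algebra.Free_Abelian_Groups"
    "HOL-Algebra.Generated_Groups"
    "Graph_Theory.Digraph_Component"
begin

text \<open>
  A finite simple undirected graph is a \<open>pair_graph\<close>: a finite loop-free digraph whose arc set is
  symmetric, an edge \<open>uv\<close> being represented by the two arcs \<open>(u, v)\<close> and \<open>(v, u)\<close>. Hence the arcs
  leaving \<open>v\<close> correspond to the edges at \<open>v\<close>, and the degree of \<open>v\<close> is its out-degree.
\<close>

abbreviation deg :: "'a pair_pre_digraph \<Rightarrow> 'a \<Rightarrow> nat" where
  "deg G v \<equiv> out_degree (with_proj G) v"

text \<open>
  The library's \<open>tree\<close> is of no use for symmetric digraphs, because its \<open>forest\<close> regards the closed
  walk \<open>u, v, u\<close> along a single edge as a cycle. In a \<open>pair_graph\<close> these are precisely the cycles of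
  length \<open>2\<close>, so the cycles of the undirected graph are those of length at least \<open>3\<close>.
\<close>

definition undirected_tree :: "'a pair_pre_digraph \<Rightarrow> bool" where
  "undirected_tree G \<longleftrightarrow>
     pair_graph G \<and> connected (with_proj G) \<and>
     \<not> (\<exists>p. pre_digraph.cycle (with_proj G) p \<and> length p \<ge> 3)"

definition leaves :: "'a pair_pre_digraph \<Rightarrow> 'a set" where
  "leaves G = {v \<in> pverts G. deg G v = 1}"

definition graph_join ::
  "'a pair_pre_digraph \<Rightarrow> 'b pair_pre_digraph \<Rightarrow> ('a + 'b) pair_pre_digraph" where
  "graph_join G H =
     \<lparr>pverts = pverts G <+> pverts H,
      parcs = {(Inl u, Inl v) | u v. (u, v) \<in> parcs G} \<union> {(Inr u, Inr v) | u v. (u, v) \<in> parcs H} \<union>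
              {(Inl u, Inr v) | u v. u \<in> pverts G \<and> v \<in> pverts H} \<union>
              {(Inr v, Inl u) | u v. u \<in> pverts G \<and> v \<in> pverts H}\<rparr>"

definition complete_graph :: "nat \<Rightarrow> nat pair_pre_digraph" where
  "complete_graph n =
     \<lparr>pverts = {1..n}, parcs = {(i, j). i \<in> {1..n} \<and> j \<in> {1..n} \<and> i \<noteq> j}\<rparr>"

definition Div :: "'a pair_pre_digraph \<Rightarrow> ('a \<Rightarrow>\<^sub>0 int) monoid" where
  "Div G = free_Abelian_group (pverts G)"

definition div_degree :: "('a \<Rightarrow>\<^sub>0 int) \<Rightarrow> int" where
  "div_degree D = (\<Sum>v\<in>Poly_Mapping.keys D. Poly_Mapping.lookup D v)"

definition Div0 :: "'a pair_pre_digraph \<Rightarrow> ('a \<Rightarrow>\<^sub>0 int) monoid" where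
  "Div0 G = (Div G)\<lparr>carrier := kernel (Div G) integer_group div_degree\<rparr>"

definition laplacian :: "'a pair_pre_digraph \<Rightarrow> ('a \<Rightarrow>\<^sub>0 int) \<Rightarrow> ('a \<Rightarrow>\<^sub>0 int)" where
  "laplacian G =
     frag_extend (\<lambda>v. frag_cmul (int (deg G v)) (frag_of v) - (\<Sum>w | (w, v) \<in> parcs G. frag_of w))"

definition laplacian_image :: "'a pair_pre_digraph \<Rightarrow> ('a \<Rightarrow>\<^sub>0 int) set" where
  "laplacian_image G = laplacian G ` carrier (Div G)"

definition Pic0 :: "'a pair_pre_digraph \<Rightarrow> ('a \<Rightarrow>\<^sub>0 int) set monoid" where
  "Pic0 G = Div0 G Mod laplacian_image G"

definition div_class :: "'a pair_pre_digraph \<Rightarrow> ('a \<Rightarrow>\<^sub>0 int) \<Rightarrow> ('a \<Rightarrow>\<^sub>0 int) set" where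
  "div_class G D = laplacian_image G #>\<^bsub>Div0 G\<^esub> D"

abbreviation tree_join :: "'a pair_pre_digraph \<Rightarrow> nat \<Rightarrow> ('a + nat) pair_pre_digraph" where
  "tree_join \<Gamma> n \<equiv> graph_join \<Gamma> (complete_graph n)"

definition join_quotient :: "'a pair_pre_digraph \<Rightarrow> nat \<Rightarrow> ('a + nat \<Rightarrow>\<^sub>0 int) set set monoid" where
  "join_quotient \<Gamma> n =
     Pic0 (tree_join \<Gamma> n) Mod
       generate (Pic0 (tree_join \<Gamma> n))
         {div_class (tree_join \<Gamma> n) (frag_of (Inr i) - frag_of (Inr j)) | i j.
            i \<in> {1..n} \<and> j \<in> {1..n}}"

lemma div_degree_eq_sum:
  assumes "finite A" "Poly_Mapping.keys D \<subseteq> A"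
  shows "div_degree D = (\<Sum>v\<in>A. Poly_Mapping.lookup D v)"
  unfolding div_degree_def using assms
  by (intro sum.mono_neutral_left) (auto simp: in_keys_iff)

lemma div_degree_add: "div_degree (D + E) = div_degree D + div_degree E"
proof -
  let ?A = "Poly_Mapping.keys D \<union> Poly_Mapping.keys E"
  have "Poly_Mapping.keys (D + E) \<subseteq> ?A" by (rule keys_add)
  then show ?thesis
    using div_degree_eq_sum[of ?A D] div_degree_eq_sum[of ?A E] div_degree_eq_sum[of ?A "D + E"]
    by (simp add: lookup_add sum.distrib)
qed

lemma div_degree_frag_of [simp]: "div_degree (frag_of v) = 1"
  by (simp add: div_degree_def)

lemma div_degree_0 [simp]: "div_degree 0 = 0"
  by (simp add: div_degree_def)

lemma div_degree_uminus: "div_degree (- D) = - div_degree D"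
  using div_degree_add[of D "- D"] by simp

lemma div_degree_diff: "div_degree (D - E) = div_degree D - div_degree E"
  using div_degree_add[of D "- E"] by (simp add: div_degree_uminus)

lemma div_degree_sum: "div_degree (sum f A) = (\<Sum>a\<in>A. div_degree (f a))"
  by (induction A rule: infinite_finite_induct) (auto simp: div_degree_add)

lemma div_degree_cmul: "div_degree (frag_cmul c D) = c * div_degree D"
  using div_degree_eq_sum[of "Poly_Mapping.keys D" "frag_cmul c D"] keys_cmul[of c D]
  by (simp add: div_degree_def sum_distrib_left)

lemma carrier_Div [simp]: "D \<in> carrier (Div G) \<longleftrightarrow> Poly_Mapping.keys D \<subseteq> pverts G"
  by (simp add: Div_def)

lemma div_degree_hom: "div_degree \<in> hom (Div G) integer_group"
  by (auto simp: hom_def Div_def div_degree_add)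

lemma comm_group_Div: "comm_group (Div G)"
  by (simp add: Div_def abelian_free_Abelian_group)

lemma carrier_Div0 [simp]:
  "D \<in> carrier (Div0 G) \<longleftrightarrow> Poly_Mapping.keys D \<subseteq> pverts G \<and> div_degree D = 0"
  by (simp add: Div0_def kernel_def)

lemma mult_Div0 [simp]: "D \<otimes>\<^bsub>Div0 G\<^esub> E = D + E"
  by (simp add: Div0_def Div_def)

lemma one_Div0 [simp]: "\<one>\<^bsub>Div0 G\<^esub> = 0"
  by (simp add: Div0_def Div_def)

lemma comm_group_Div0: "comm_group (Div0 G)"
proof -
  interpret group_hom "Div G" integer_group div_degree
    using comm_group_Div[of G] div_degree_hom[of G]
    by (simp add: group_hom_def group_hom_axioms_def comm_group_def)
  have "group (Div0 G)"
    unfolding Div0_def by (rule subgroup.subgroup_is_group[OF subgroup_kernel G.is_group])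
  then show ?thesis
    by (rule group.group_comm_groupI) (simp add: add.commute)
qed

lemma laplacian_in_Div0:
  assumes "pair_graph G" "D \<in> carrier (Div G)"
  shows "laplacian G D \<in> carrier (Div0 G)"
proof -
  interpret pair_graph G by fact
  let ?b = "\<lambda>v. frag_cmul (int (deg G v)) (frag_of v) - (\<Sum>w | (w, v) \<in> parcs G. frag_of w)"
  have vert: "v \<in> pverts G" if "(v, w) \<in> parcs G" for v w
    using that arc_fst_in_verts by fastforce
  have card: "deg G v = card {w. (w, v) \<in> parcs G}" for v
  proof -
    have "out_arcs G v = Pair v ` {w. (w, v) \<in> parcs G}"
      using arcs_symmetric by (fastforce simp: out_arcs_def)
    then show ?thesis by (simp add: out_degree_def card_image inj_on_def)
  qed
  have deg0: "div_degree (?b v) = 0" for v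
    by (simp add: div_degree_diff div_degree_cmul div_degree_sum card)
  have keys_sum: "Poly_Mapping.keys (\<Sum>w | (w, v) \<in> parcs G. frag_of w) \<subseteq> pverts G" for v
    using keys_sum[of frag_of "{w. (w, v) \<in> parcs G}"] vert by fastforce
  have keys: "Poly_Mapping.keys (?b v) \<subseteq> pverts G" if "v \<in> pverts G" for v
    using that keys_sum[of v]
      keys_diff[of "frag_cmul (int (deg G v)) (frag_of v)" "\<Sum>w | (w, v) \<in> parcs G. frag_of w"]
    by (auto simp: subset_iff)
  have "Poly_Mapping.keys (laplacian G D) \<subseteq> (\<Union>v\<in>Poly_Mapping.keys D. Poly_Mapping.keys (?b v))"
    unfolding laplacian_def by (rule keys_frag_extend)
  then have "Poly_Mapping.keys (laplacian G D) \<subseteq> pverts G"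
    using keys assms(2) unfolding carrier_Div by blast
  moreover have "div_degree (laplacian G D) = 0"
    unfolding laplacian_def frag_extend_def by (simp only: div_degree_sum div_degree_cmul deg0) simp
  ultimately show ?thesis by simp
qed

lemma laplacian_hom:
  assumes "pair_graph G"
  shows "laplacian G \<in> hom (Div G) (Div0 G)"
proof (rule homI)
  show "laplacian G D \<in> carrier (Div0 G)" if "D \<in> carrier (Div G)" for D
    using laplacian_in_Div0[OF assms that] .
  show "laplacian G (D \<otimes>\<^bsub>Div G\<^esub> E) = laplacian G D \<otimes>\<^bsub>Div0 G\<^esub> laplacian G E" for D E
    by (simp add: Div_def laplacian_def frag_extend_add)
qed

lemma laplacian_image_subgroup:
  assumes "pair_graph G"
  shows "subgroup (laplacian_image G) (Div0 G)"
proof -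
  interpret group_hom "Div G" "Div0 G" "laplacian G"
    using comm_group_Div[of G] comm_group_Div0[of G] laplacian_hom[OF assms]
    by (simp add: group_hom_def group_hom_axioms_def comm_group_def)
  show ?thesis
    unfolding laplacian_image_def by (rule img_is_subgroup)
qed

lemma comm_group_Pic0:
  assumes "pair_graph G"
  shows "comm_group (Pic0 G)"
  unfolding Pic0_def
  by (rule comm_group.abelian_FactGroup[OF comm_group_Div0 laplacian_image_subgroup[OF assms]])

lemma div_class_in_Pic0:
  assumes "D \<in> carrier (Div0 G)"
  shows "div_class G D \<in> carrier (Pic0 G)"
  using assms by (auto simp: Pic0_def div_class_def FactGroup_def RCOSETS_def)

lemma pair_graph_complete_graph: "pair_graph (complete_graph n)"
proof
  show "finite (parcs (complete_graph n))"
    by (rule finite_subset[of _ "{1..n} \<times> {1..n}"]) (auto simp: complete_graph_def)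
qed (auto simp: complete_graph_def symmetric_def sym_def)

lemma pair_graph_join:
  assumes "pair_graph G" "pair_graph H"
  shows "pair_graph (graph_join G H)"
proof -
  interpret G: pair_graph G by fact
  interpret H: pair_graph H by fact
  have wf: "fst e \<in> pverts (graph_join G H) \<and> snd e \<in> pverts (graph_join G H)"
    if "e \<in> parcs (graph_join G H)" for e
    using that
    by (auto simp: graph_join_def dest: G.arc_fst_in_verts G.arc_snd_in_verts
        H.arc_fst_in_verts H.arc_snd_in_verts)
  have fin: "finite (pverts (graph_join G H))"
    by (simp add: graph_join_def G.pair_finite_verts H.pair_finite_verts)
  show ?thesis
  proof
    show "finite (parcs (graph_join G H))"
      by (rule finite_subset[OF _ finite_cartesian_product[OF fin fin]]) (use wf in force)
    show "symmetric (with_proj (graph_join G H))"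
      using G.arcs_symmetric H.arcs_symmetric
      by (auto simp: symmetric_def sym_def graph_join_def)
    show "fst e \<noteq> snd e" if "e \<in> parcs (graph_join G H)" for e
      using that G.pair_no_loops H.pair_no_loops by (fastforce simp: graph_join_def)
  qed (use wf fin in auto)
qed

lemma comm_group_join_quotient:
  assumes "pair_graph \<Gamma>"
  shows "comm_group (join_quotient \<Gamma> n)"
proof -
  let ?G = "tree_join \<Gamma> n"
  have G: "pair_graph ?G" using assms by (intro pair_graph_join pair_graph_complete_graph)
  have "frag_of (Inr i) - frag_of (Inr j) \<in> carrier (Div0 ?G)" if "i \<in> {1..n}" "j \<in> {1..n}" for i j
    using that keys_diff[of "frag_of (Inr i :: 'a + nat)" "frag_of (Inr j)"]
    by (auto simp: div_degree_diff graph_join_def complete_graph_def)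
  then have "{div_class ?G (frag_of (Inr i) - frag_of (Inr j)) | i j. i \<in> {1..n} \<and> j \<in> {1..n}}
    \<subseteq> carrier (Pic0 ?G)" using div_class_in_Pic0 by blast
  then show ?thesis
    unfolding join_quotient_def using comm_group_Pic0[OF G]
    by (intro comm_group.abelian_FactGroup group.generate_is_subgroup comm_group.axioms)
qed

end

theory Submission
  imports Defs
begin

text \<open>
  In \<open>H\<^sub>n\<close> put \<open>x\<^sub>v = [v - w\<^sub>1]\<close> for \<open>v\<close> in the tree; these classes generate, and firing \<open>c\<close> gives
  \<open>(deg c + n) x\<^sub>c = \<Sum> x\<^sub>u\<close>, summed over the tree neighbours \<open>u\<close> of \<open>c\<close>. Root the tree at a leaf \<open>r\<close>.
  Read as a formula for its parent, the relation at \<open>c\<close> lets one climb from the other leaves to the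
  root, so the \<open>l\<close> classes \<open>x\<^sub>v\<close> of the leaves \<open>v \<noteq> r\<close> suffice.
\<close>

section \<open>Degrees and longest paths in a tree\<close>

lemma (in pair_graph) deg_eq_card_neighbours: "deg G v = card {w. (v, w) \<in> parcs G}"
proof -
  have "out_arcs G v = Pair v ` {w. (v, w) \<in> parcs G}"
    by (auto simp: out_arcs_def)
  then show ?thesis by (simp add: out_degree_def card_image inj_on_def)
qed

text \<open>If \<open>c\<close> were already on the path, its segment from \<open>c\<close> to
  \<open>v\<close> followed by the arc \<open>(v, c)\<close> would be a cycle. Since the path did
  not arrive along \<open>(c, v)\<close>, that cycle has length at least 3, which a tree
  excludes.\<close>

lemma apath_extend_in_tree:
  assumes tree: "undirected_tree G"
    and path: "pre_digraph.apath (with_proj G) r p v"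
    and arc: "(v, c) \<in> parcs G"
    and no_back: "p \<noteq> [] \<Longrightarrow> last p \<noteq> (c, v)"
  shows "pre_digraph.apath (with_proj G) r (p @ [(v, c)]) c"
proof -
  interpret pair_graph G using tree by (simp add: undirected_tree_def)
  have loop: "v \<noteq> c" using arc pair_no_loops by fastforce
  have walk: "awalk r p v" and dist: "distinct (awalk_verts r p)"
    using path by (auto simp: apath_def)
  have cV: "c \<in> pverts G" and vV: "v \<in> pverts G"
    using arc arc_snd_in_verts arc_fst_in_verts by fastforce+
  have last: "awlast r p = v" using walk by auto
  have arc_path: "apath v [(v, c)] c"
    using arc loop cV by (auto simp: apath_simps)
  have "c \<notin> set (awalk_verts r p)"
  proof
    assume "c \<in> set (awalk_verts r p)"
    then obtain q s where qs: "p = q @ s" "awalk r q c" "awalk c s v"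
      using awalk_decomp[OF walk] by blast
    have lastq: "awlast r q = c" using qs by auto
    have s_path: "apath c s v"
      using path lastq unfolding qs(1) apath_append_iff by simp
    have s_ne: "s \<noteq> []" using qs(3) loop by (auto simp: awalk_Nil_iff)
    \<comment> \<open>A segment of length 1 would close up to the 2-cycle that every edge yields in
      a symmetric digraph and that \<open>undirected_tree\<close> allows; \<open>no_back\<close>
      rules it out.\<close>
    have "length s \<noteq> 1"
    proof
      assume "length s = 1"
      then obtain e where "s = [e]" by (auto simp: length_Suc_conv)
      with qs(3) have "s = [(c, v)]" by (cases e) (auto simp: awalk_simps)
      with no_back qs(1) show False by simp
    qed
    with s_ne have len: "length (s @ [(v, c)]) \<ge> 3"
      by (cases s) (auto simp: Suc_le_eq)
    have walk': "awalk c (s @ [(v, c)]) c"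
      using qs(3) arc_path by (auto simp: apath_def)
    have "awlast c s = v" using qs(3) by auto
    then have "awalk_verts c (s @ [(v, c)]) = awalk_verts c s @ [c]"
      using awalk_verts_append[OF walk'] by simp
    \<comment> \<open>A cycle needs a distinct vertex list only after its head is dropped; there
      \<open>c\<close>, the head of the list of \<open>s\<close>, occurs just once, at the
      end.\<close>
    moreover obtain vs where vs: "awalk_verts c s = c # vs"
      using qs(3) by (metis awalkE' awalk_verts_non_Nil list.collapse)
    ultimately have "distinct (tl (awalk_verts c (s @ [(v, c)])))"
      using s_path by (auto simp: apath_def)
    then have "cycle (s @ [(v, c)])"
      using walk' unfolding cycle_def by blast
    with len tree show False unfolding undirected_tree_def by blast
  qed
  then show ?thesis
    using path arc_path last by (simp add: apath_append_iff)
qed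

text \<open>
  A longest path from \<open>r\<close> ending in \<open>B\<close> could always be prolonged: its end has a further neighbour
  \<open>c\<close>, and either \<open>c\<close> or a further neighbour of \<open>c\<close> lies in \<open>B\<close>.
\<close>

lemma tree_propagation:
  assumes tree: "undirected_tree G"
    and r: "r \<in> leaves G"
    and B: "B \<subseteq> pverts G"
    and B_leaves: "B \<inter> leaves G \<subseteq> {r}"
    and step: "\<And>c v. c \<in> pverts G \<Longrightarrow> c \<notin> B \<Longrightarrow> v \<in> B \<Longrightarrow> (c, v) \<in> parcs G \<Longrightarrow>
                 \<exists>v'\<in>B. v' \<noteq> v \<and> (c, v') \<in> parcs G"
  shows "B = {}"
proof (rule ccontr)
  assume "B \<noteq> {}"
  interpret pair_graph G using tree by (simp add: undirected_tree_def)
  have rV: "r \<in> pverts G" using r by (simp add: leaves_def)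
  let ?P = "\<lambda>p. \<exists>v\<in>B. apath r p v"
  obtain b where b: "b \<in> B" using \<open>B \<noteq> {}\<close> by blast
  have "strongly_connected G"
    using tree symmetric_connected_imp_strongly_connected sym_arcs
    by (auto simp: undirected_tree_def)
  then have "r \<rightarrow>\<^sup>*\<^bsub>with_proj G\<^esub> b" using rV b B by (auto simp: strongly_connected_def)
  then obtain p0 where "awalk r p0 b" by (auto simp: reachable_awalk)
  then have "?P (awalk_to_apath p0)" using apath_awalk_to_apath b by blast
  \<comment> \<open>The number of vertices bounds the length of a path, so a longest one
    exists.\<close>
  moreover have "\<forall>p. ?P p \<longrightarrow> length p < Suc (card (verts G))"
    using length_apath by (auto simp: less_Suc_eq_le)
  ultimately obtain p where P: "?P p" and max: "\<And>q. ?P q \<Longrightarrow> length q \<le> length p"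
    using ex_has_greatest_nat[of ?P _ length] by blast
  then obtain v where v: "v \<in> B" "apath r p v" by blast
  \<comment> \<open>The path must leave \<open>v\<close> by a neighbour other than the one it came
    from. At \<open>r\<close> any neighbour serves, and a leaf has one; an end \<open>v\<close>
    other than \<open>r\<close> lies in \<open>B\<close>, so it is not a leaf and has a second
    neighbour.\<close>
  have "\<exists>c. (v, c) \<in> parcs G \<and> (p \<noteq> [] \<longrightarrow> last p \<noteq> (c, v))"
  proof (cases p rule: rev_cases)
    case Nil
    then have "v = r" using v(2) by (simp add: apath_Nil_iff)
    then have "card {w. (v, w) \<in> parcs G} \<noteq> 0"
      using r deg_eq_card_neighbours[of r] by (simp add: leaves_def)
    then have "{w. (v, w) \<in> parcs G} \<noteq> {}" by (metis card.empty)
    then show ?thesis using Nil by auto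
  next
    case (snoc q e)
    obtain x y where e: "e = (x, y)" by (cases e)
    have walk: "awalk r p v" using v(2) by (simp add: apath_def)
    then have xv: "(x, v) \<in> parcs G" "y = v"
      unfolding snoc e by (auto simp: awalk_simps)
    then have x: "x \<in> {w. (v, w) \<in> parcs G}" using arcs_symmetric by auto
    have "v \<noteq> r" using apath_nonempty_ends[OF v(2)] snoc by auto
    then have "card {w. (v, w) \<in> parcs G} \<noteq> 1"
      using B_leaves v(1) B deg_eq_card_neighbours[of v] by (auto simp: leaves_def)
    then have "{w. (v, w) \<in> parcs G} \<noteq> {x}" by auto
    with x obtain c where "(v, c) \<in> parcs G" "c \<noteq> x" by blast
    then show ?thesis using snoc e by auto
  qed
  then obtain c where c: "(v, c) \<in> parcs G" "p \<noteq> [] \<Longrightarrow> last p \<noteq> (c, v)" by blast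
  have path: "apath r (p @ [(v, c)]) c"
    using apath_extend_in_tree[OF tree v(2) c] .
  show False
  proof (cases "c \<in> B")
    case True
    then show False using max path by fastforce
  next
    case False
    have "(c, v) \<in> parcs G" using c(1) arcs_symmetric by auto
    moreover have "c \<in> pverts G" using c(1) arc_snd_in_verts by fastforce
    ultimately obtain v' where v': "v' \<in> B" "v' \<noteq> v" "(c, v') \<in> parcs G"
      using step False v(1) by blast
    \<comment> \<open>The second prolongation does not turn back, because \<open>v'\<close> differs
      from \<open>v\<close>.\<close>
    have "apath r ((p @ [(v, c)]) @ [(c, v')]) v'"
      using apath_extend_in_tree[OF tree path v'(3)] v'(2) by simp
    then show False using max v'(1) by fastforce
  qed
qed

section \<open>Laplacian relations in the join\<close>

lemma frag_cmul_closed: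
  assumes "(0::'a \<Rightarrow>\<^sub>0 int) \<in> T" "\<And>D E. D \<in> T \<Longrightarrow> E \<in> T \<Longrightarrow> D + E \<in> T"
    "\<And>D. D \<in> T \<Longrightarrow> - D \<in> T" "D \<in> T"
  shows "frag_cmul k D \<in> T"
proof (induction k rule: int_induct[where k = 0])
  case base
  show ?case using assms(1) by simp
next
  case (step1 i)
  then show ?case using assms by (simp add: frag_cmul_distrib)
next
  case (step2 i)
  have "frag_cmul (i - 1) D = frag_cmul i D + - D"
    using frag_cmul_distrib[of i "-1" D] by simp
  then show ?case using step2 assms(2-4) by metis
qed

lemma frag_cmul_sum_left: "frag_cmul (sum f A) D = (\<Sum>a\<in>A. frag_cmul (f a) D)"
  by (induction A rule: infinite_finite_induct) (auto simp: frag_cmul_distrib)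

text \<open>The degree counts arcs out of \<open>v\<close>, the sum in \<open>laplacian\<close> runs
  over arcs into \<open>v\<close>; symmetry matches them, one copy of \<open>v\<close> for each
  neighbour. In a sum of differences a common base point can be subtracted from all
  vertices.\<close>

lemma laplacian_frag_of:
  assumes "pair_graph G"
  shows "laplacian G (frag_of v) = (\<Sum>u | (u, v) \<in> parcs G. frag_of v - frag_of u)"
proof -
  interpret pair_graph G by fact
  have nb: "{w. (v, w) \<in> parcs G} = {w. (w, v) \<in> parcs G}"
    using arcs_symmetric by auto
  have const: "(\<Sum>u\<in>A. D) = frag_cmul (int (card A)) D" for A :: "'a set" and D :: "'a \<Rightarrow>\<^sub>0 int"
    using frag_cmul_sum_left[of "\<lambda>_. 1" A D] by simp
  show ?thesis
    by (simp add: laplacian_def sum_subtractf const deg_eq_card_neighbours nb)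
qed

text \<open>The neighbours of \<open>Inl c\<close> are the tree neighbours of \<open>c\<close> and
  all vertices of the complete graph. Once every \<open>Inr i\<close> is identified with
  \<open>Inr 1\<close>, setting this divisor to 0 gives the relation (deg c + n) x_c = \<Sum>
  x_u.\<close>

lemma laplacian_tree_join:
  assumes "pair_graph \<Gamma>" "c \<in> pverts \<Gamma>"
  shows "laplacian (tree_join \<Gamma> n) (frag_of (Inl c)) =
    (\<Sum>u | (c, u) \<in> parcs \<Gamma>. frag_of (Inl c) - frag_of (Inl u)) +
    (\<Sum>i\<in>{1..n}. frag_of (Inl c) - frag_of (Inr i))"
proof -
  interpret pair_graph \<Gamma> by fact
  let ?N = "{u. (c, u) \<in> parcs \<Gamma>}"
  have N: "{u. (u, Inl c) \<in> parcs (tree_join \<Gamma> n)} = Inl ` ?N \<union> Inr ` {1..n}"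
    using arcs_symmetric assms(2) by (auto simp: graph_join_def complete_graph_def)
  have "finite ?N"
    by (rule finite_subset[of _ "snd ` parcs \<Gamma>"]) (auto simp: image_iff, force)
  then have "(\<Sum>u\<in>Inl ` ?N \<union> Inr ` {1..n}. frag_of (Inl c) - frag_of u) =
      (\<Sum>u\<in>Inl ` ?N. frag_of (Inl c) - frag_of u) + (\<Sum>u\<in>Inr ` {1..n}. frag_of (Inl c) - frag_of u)"
    by (intro sum.union_disjoint) auto
  then show ?thesis
    using pair_graph_join[OF assms(1) pair_graph_complete_graph]
    by (simp add: laplacian_frag_of N sum.reindex)
qed

text \<open>
  The relation at \<open>c\<close> expresses any one neighbour of \<open>c\<close> through \<open>c\<close> and the remaining neighbours,
  so \<open>tree_propagation\<close> applies to the vertices \<open>v\<close> for which \<open>v - w\<^sub>1\<close> is not in \<open>T\<close>.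
\<close>

lemma Div0_tree_join_subset:
  assumes tree: "undirected_tree \<Gamma>"
    and r: "r \<in> leaves \<Gamma>"
    and n: "n \<ge> 1"
    and zero: "0 \<in> T"
    and add: "\<And>D E. D \<in> T \<Longrightarrow> E \<in> T \<Longrightarrow> D + E \<in> T"
    and neg: "\<And>D. D \<in> T \<Longrightarrow> - D \<in> T"
    and lap: "laplacian_image (tree_join \<Gamma> n) \<subseteq> T"
    and diffs: "\<And>i j. i \<in> {1..n} \<Longrightarrow> j \<in> {1..n} \<Longrightarrow> frag_of (Inr i) - frag_of (Inr j) \<in> T"
    and lvs: "\<And>v. v \<in> leaves \<Gamma> - {r} \<Longrightarrow> frag_of (Inl v) - frag_of (Inr 1) \<in> T"
  shows "carrier (Div0 (tree_join \<Gamma> n)) \<subseteq> T"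
proof -
  interpret pair_graph \<Gamma> using tree by (simp add: undirected_tree_def)
  have pg: "pair_graph \<Gamma>" by unfold_locales
  \<comment> \<open>\<open>y u\<close> represents the class x_u, with \<open>Inr 1\<close> as base
    point.\<close>
  define y where "y = (\<lambda>u :: 'a + nat. frag_of u - frag_of (Inr 1))"
  have sub: "D - E \<in> T" if "D \<in> T" "E \<in> T" for D E
    using add[OF that(1) neg[OF that(2)]] by simp
  have sumT: "(\<Sum>a\<in>A. f a) \<in> T" if "\<And>a. a \<in> A \<Longrightarrow> f a \<in> T" for f and A :: "'c set"
    using that by (induction A rule: infinite_finite_induct) (auto simp: zero add)
  have y_diff: "frag_of u - frag_of v = y u - y v" for u v by (simp add: y_def)
  have yw: "y (Inr i) \<in> T" if "i \<in> {1..n}" for i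
    using diffs[OF that, of 1] n by (simp add: y_def)
  define B where "B = {v \<in> pverts \<Gamma>. y (Inl v) \<notin> T}"
  have "B = {}"
  proof (rule tree_propagation[OF tree r])
    show "B \<subseteq> pverts \<Gamma>" by (auto simp: B_def)
    show "B \<inter> leaves \<Gamma> \<subseteq> {r}" using lvs by (auto simp: B_def y_def)
    fix c v assume c: "c \<in> pverts \<Gamma>" "c \<notin> B" and v: "v \<in> B" "(c, v) \<in> parcs \<Gamma>"
    show "\<exists>v'\<in>B. v' \<noteq> v \<and> (c, v') \<in> parcs \<Gamma>"
    proof (rule ccontr)
      assume contra: "\<not> ?thesis"
      let ?N = "{u. (c, u) \<in> parcs \<Gamma>}"
      let ?d = "\<lambda>u. y (Inl c) - y u"
      have yc: "y (Inl c) \<in> T" using c by (simp add: B_def)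
      have yN: "y (Inl u) \<in> T" if "u \<in> ?N - {v}" for u
        using that contra arc_snd_in_verts[of "(c, u)"] by (auto simp: B_def)
      have "frag_of (Inl c) \<in> carrier (Div (tree_join \<Gamma> n))"
        using c by (auto simp: graph_join_def)
      then have "laplacian (tree_join \<Gamma> n) (frag_of (Inl c)) \<in> T"
        using lap by (auto simp: laplacian_image_def)
      \<comment> \<open>In this relation every term except the one for \<open>v\<close> lies in
        \<open>T\<close>: by \<open>contra\<close>, \<open>v\<close> is the only neighbour of
        \<open>c\<close> in \<open>B\<close>.\<close>
      then have L: "(\<Sum>u\<in>?N. ?d (Inl u)) + (\<Sum>i\<in>{1..n}. ?d (Inr i)) \<in> T"
        by (simp only: laplacian_tree_join[OF pg c(1)] y_diff)
      have "finite ?N"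
        by (rule finite_subset[of _ "snd ` parcs \<Gamma>"]) (auto simp: image_iff, force)
      then have N: "(\<Sum>u\<in>?N. ?d (Inl u)) = ?d (Inl v) + (\<Sum>u\<in>?N - {v}. ?d (Inl u))"
        using v(2) by (intro sum.remove) auto
      have "(\<Sum>u\<in>?N - {v}. ?d (Inl u)) \<in> T" using yN yc by (intro sumT sub) auto
      moreover have "(\<Sum>i\<in>{1..n}. ?d (Inr i)) \<in> T" using yw yc by (intro sumT sub) auto
      ultimately have "?d (Inl v) \<in> T"
        using sub[OF sub[OF L]] unfolding N by force
      then have "y (Inl v) \<in> T" using sub[OF yc] by force
      with v(1) show False by (simp add: B_def)
    qed
  qed
  then have y_in: "y u \<in> T" if "u \<in> pverts (tree_join \<Gamma> n)" for u
    using that yw by (auto simp: B_def graph_join_def complete_graph_def)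
  show ?thesis
  proof
    fix D assume D: "D \<in> carrier (Div0 (tree_join \<Gamma> n))"
    let ?K = "Poly_Mapping.keys D" and ?c = "Poly_Mapping.lookup D"
    have "(\<Sum>k\<in>?K. frag_cmul (?c k) (frag_of k)) = D"
      using frag_expansion[of D, symmetric] unfolding frag_extend_def .
    \<comment> \<open>Degree 0 makes the base point cancel, so \<open>D\<close> is an integer
      combination of the \<open>y k\<close>.\<close>
    moreover have "(\<Sum>k\<in>?K. frag_cmul (?c k) (frag_of (Inr 1 :: 'a + nat))) = 0"
    proof -
      have "(\<Sum>k\<in>?K. frag_cmul (?c k) (frag_of (Inr 1 :: 'a + nat))) = frag_cmul (\<Sum>k\<in>?K. ?c k) (frag_of (Inr 1))"
        by (rule frag_cmul_sum_left[symmetric])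
      then show ?thesis using D by (simp add: div_degree_def)
    qed
    moreover have "frag_cmul k (y u) = frag_cmul k (frag_of u) - frag_cmul k (frag_of (Inr 1))" for k u
      unfolding y_def by (rule poly_mapping_eqI) (simp add: lookup_minus right_diff_distrib)
    ultimately have "D = (\<Sum>k\<in>?K. frag_cmul (?c k) (y k))"
      by (simp only: sum_subtractf diff_zero)
    also have "\<dots> \<in> T"
      using D y_in by (intro sumT frag_cmul_closed zero add neg) auto
    finally show "D \<in> T" .
  qed
qed

section \<open>Passage to the quotient group\<close>

lemma (in group_hom) subgroup_preimage:
  assumes "subgroup S H"
  shows "subgroup {x \<in> carrier G. h x \<in> S} G"
  using assms by (auto intro!: G.subgroupI exI[of _ "\<one>"] simp: subgroup.m_closed subgroup.m_inv_closed subgroup.one_closed)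

theorem theoremB:
  fixes \<Gamma> :: "'a pair_pre_digraph" and l n :: nat
  assumes "undirected_tree \<Gamma>"
    and "card (leaves \<Gamma>) = l + 1"
    and "l + 1 \<ge> 2"
    and "n \<ge> 1"
  shows "\<exists>g \<in> {1..l} \<rightarrow> carrier (join_quotient \<Gamma> n).
           generate (join_quotient \<Gamma> n) (g ` {1..l}) = carrier (join_quotient \<Gamma> n)"
proof -
  have pg: "pair_graph \<Gamma>" using assms(1) by (simp add: undirected_tree_def)
  define G where "G = tree_join \<Gamma> n"
  have pG: "pair_graph G"
    unfolding G_def using pg by (intro pair_graph_join pair_graph_complete_graph)
  define W where "W = {div_class G (frag_of (Inr i) - frag_of (Inr j)) | i j. i \<in> {1..n} \<and> j \<in> {1..n}}"
  define N where "N = generate (Pic0 G) W"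
  define J where "J = join_quotient \<Gamma> n"
  have J: "J = Pic0 G Mod N" by (simp add: J_def join_quotient_def G_def N_def W_def)
  interpret D: comm_group "Div0 G" by (rule comm_group_Div0)
  interpret P: comm_group "Pic0 G" using comm_group_Pic0[OF pG] .
  interpret J: comm_group J unfolding J_def using comm_group_join_quotient[OF pg] .
  have diff_in: "frag_of u - frag_of v \<in> carrier (Div0 G)"
    if "u \<in> pverts G" "v \<in> pverts G" for u v
    using that keys_diff[of "frag_of u" "frag_of v"] by (auto simp: div_degree_diff)
  have Inr_in: "Inr i \<in> pverts G" if "i \<in> {1..n}" for i
    using that by (auto simp: G_def graph_join_def complete_graph_def)
  have W: "W \<subseteq> carrier (Pic0 G)"
    using diff_in Inr_in div_class_in_Pic0 unfolding W_def by blast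
  interpret LI: normal "laplacian_image G" "Div0 G"
    using laplacian_image_subgroup[OF pG] by (simp add: D.normal_iff_subgroup)
  interpret N: normal N "Pic0 G"
    using P.generate_is_subgroup[OF W] by (simp add: P.normal_iff_subgroup N_def)
  \<comment> \<open>The composite of the two quotient maps; through it, generation of
    \<open>J\<close> becomes a statement about divisors.\<close>
  define \<phi> where "\<phi> = (\<lambda>D. N #>\<^bsub>Pic0 G\<^esub> div_class G D)"
  have class_hom: "div_class G \<in> hom (Div0 G) (Pic0 G)"
    using LI.r_coset_hom_Mod by (simp add: div_class_def[abs_def] Pic0_def)
  have "\<phi> \<in> hom (Div0 G) J"
    using hom_compose[OF class_hom N.r_coset_hom_Mod] by (simp add: J \<phi>_def o_def)
  then interpret \<phi>: group_hom "Div0 G" J \<phi> by unfold_locales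
  have surj: "carrier J = \<phi> ` carrier (Div0 G)"
    by (auto simp: J \<phi>_def carrier_FactGroup Pic0_def div_class_def image_image)
  have "leaves \<Gamma> \<noteq> {}" using assms(2) by auto
  then obtain r where r: "r \<in> leaves \<Gamma>" by blast
  have fin: "finite (leaves \<Gamma>)" using assms(2) card.infinite by fastforce
  \<comment> \<open>Leaving out the root leaf \<open>r\<close> turns the \<open>l + 1\<close> leaves
    into the \<open>l\<close> generators.\<close>
  then have "card (leaves \<Gamma> - {r}) = card {1..l}" using r assms(2) by simp
  then obtain h where h: "bij_betw h {1..l} (leaves \<Gamma> - {r})"
    using fin by (metis finite_Diff finite_atLeastAtMost finite_same_card_bij)
  define g where "g = (\<lambda>i. \<phi> (frag_of (Inl (h i)) - frag_of (Inr 1)))"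
  have leaf_in: "frag_of (Inl v) - frag_of (Inr 1) \<in> carrier (Div0 G)" if "v \<in> leaves \<Gamma>" for v
    using that assms(4) Inr_in by (intro diff_in) (auto simp: leaves_def G_def graph_join_def)
  have g: "g \<in> {1..l} \<rightarrow> carrier J"
  proof
    fix i assume "i \<in> {1..l}"
    then have "h i \<in> leaves \<Gamma>" using h by (auto simp: bij_betw_def)
    then show "g i \<in> carrier J" unfolding g_def by (intro \<phi>.hom_closed leaf_in)
  qed
  define S where "S = generate J (g ` {1..l})"
  have S: "subgroup S J" unfolding S_def using g by (intro J.generate_is_subgroup) auto
  \<comment> \<open>As \<phi> is onto, \<open>S\<close> is all of \<open>J\<close> as soon as its
    preimage \<open>T\<close> contains every divisor of degree 0.\<close>
  define T where "T = {D \<in> carrier (Div0 G). \<phi> D \<in> S}"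
  interpret T: subgroup T "Div0 G"
    unfolding T_def by (rule \<phi>.subgroup_preimage[OF S])
  have inv_Div0: "inv\<^bsub>Div0 G\<^esub> D = - D" if "D \<in> carrier (Div0 G)" for D
    using that by (intro D.inv_equality) (auto simp: div_degree_uminus)
  have "carrier (Div0 G) \<subseteq> T"
  proof (rule Div0_tree_join_subset[OF assms(1) r assms(4), folded G_def])
    show "0 \<in> T" using T.one_closed by simp
    show "D + E \<in> T" if "D \<in> T" "E \<in> T" for D E using T.m_closed[OF that] by simp
    show "- D \<in> T" if "D \<in> T" for D
      using T.m_inv_closed[OF that] inv_Div0 T.mem_carrier[OF that] by simp
    have triv: "\<phi> D = \<one>\<^bsub>J\<^esub>" if "div_class G D \<in> N" for D
      using that P.coset_join2[OF N.mem_carrier[OF that] N.subgroup_axioms] by (simp add: \<phi>_def J)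
    show "laplacian_image G \<subseteq> T"
    proof
      fix D assume D: "D \<in> laplacian_image G"
      then have "div_class G D = \<one>\<^bsub>Pic0 G\<^esub>"
        using D.coset_join2[OF LI.mem_carrier[OF D] LI.subgroup_axioms] by (simp add: div_class_def Pic0_def)
      then have "\<phi> D = \<one>\<^bsub>J\<^esub>" using N.one_closed by (intro triv) simp
      then show "D \<in> T" using S LI.mem_carrier[OF D] subgroup.one_closed[OF S] by (simp add: T_def)
    qed
    show "frag_of (Inr i) - frag_of (Inr j) \<in> T" if "i \<in> {1..n}" "j \<in> {1..n}" for i j
    proof -
      have "div_class G (frag_of (Inr i) - frag_of (Inr j)) \<in> N"
        unfolding N_def using that by (intro generate.incl) (auto simp: W_def)
      from triv[OF this] show ?thesis
        using diff_in[OF Inr_in[OF that(1)] Inr_in[OF that(2)]] subgroup.one_closed[OF S]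
        by (simp add: T_def)
    qed
    show "frag_of (Inl v) - frag_of (Inr 1) \<in> T" if "v \<in> leaves \<Gamma> - {r}" for v
    proof -
      have "v \<in> h ` {1..l}" using that by (simp only: bij_betw_imp_surj_on[OF h])
      then obtain i where "i \<in> {1..l}" "v = h i" by (rule imageE)
      then have "\<phi> (frag_of (Inl v) - frag_of (Inr 1)) \<in> S"
        unfolding S_def by (intro generate.incl) (auto simp: g_def)
      then show ?thesis using leaf_in that by (simp add: T_def)
    qed
  qed
  then have "carrier J \<subseteq> S" unfolding surj T_def by auto
  then have "S = carrier J" using subgroup.subset[OF S] by blast
  then show ?thesis using g unfolding S_def J_def by blast
qed

end
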